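(* Let $\mathcal{E}_1,\mathcal{E}$ be finite dimensional Hilbert spaces, $h:\mathcal{E}_1\to(-\infty,\infty]$ a proper closed convex function, $G:\mathcal{E}_1\to\mathcal{E}$ a linear map and $b\in G\,\mathrm{ri}(\operatorname{dom}h)$. Suppose further that $h(x)=h_0(x)+\delta_{\Theta}(x)$, where $\Theta$ is a compact convex set and $h_0$ is a real-valued convex function. Let $H(x)=h(x)+\delta_{\{b\}}(Gx)$. If $H$ is a KL function with exponent $\alpha\in[0,1)$, then there exist $\epsilon>0$, $c_0>0$ and $\eta>0$ such that $$\operatorname{dist}(x,\operatorname{Argmin}H)\le c_0\left|h(x)+\eta\|Gx-b\|-\inf H\right|^{1-\alpha}$$ whenever $\operatorname{dist}(x,\operatorname{Argmin}H)\le\epsilon$.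
   Context: $\delta_{C}$ is the indicator function of $C$ ($0$ on $C$, $\infty$ elsewhere); $\operatorname{dom}$ is the effective domain; $\mathrm{ri}$ the relative interior; $\operatorname{Argmin}$ the set of minimizers; $\operatorname{dist}(x,C)=\inf_{y\in C}\|x-y\|$; $\partial$ the convex subdifferential and $\operatorname{dom}\partial H=\{x:\partial H(x)\ne\emptyset\}$. When $h(x)=\infty$ the right-hand side of the inequality is read as $\infty$. A proper closed convex function $H$ satisfies the KL property with exponent $\alpha\in[0,1)$ at $\bar x\in\operatorname{dom}\partial H$ if there exist $r\in(0,\infty]$, $\rho>0$ and a neighborhood $U$ of $\bar x$ such that, with $\phi(s)=\rho s^{1-\alpha}$ on $[0,r)$, one has $\phi'(H(x)-H(\bar x))\operatorname{dist}(0,\partial H(x))\ge1$ for all $x\in U$ with $H(\bar x)<H(x)<H(\bar x)+r$ (with $\operatorname{dist}(0,\emptyset)=\infty$). $H$ is a KL function with exponent $\alpha$ if it satisfies the KL property with exponent $\alpha$ at every point of $\operatorname{dom}\partial H$. *)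

theory Defs
  imports "HOL-Analysis.Analysis"
begin

text \<open>
  Functions with values in the half-open interval from minus infinity (excluded) to plus infinity
  are rendered as \<^typ>\<open>'a \<Rightarrow> ereal\<close>; the value \<open>-\<infinity>\<close> is excluded by \<open>proper_fun\<close>.
\<close>

definition edom :: "('a \<Rightarrow> ereal) \<Rightarrow> 'a set" where
  "edom f = {x. f x < \<infinity>}"

definition proper_fun :: "('a \<Rightarrow> ereal) \<Rightarrow> bool" where
  "proper_fun f \<longleftrightarrow> (\<forall>x. f x \<noteq> -\<infinity>) \<and> edom f \<noteq> {}"

definition eepigraph :: "('a \<Rightarrow> ereal) \<Rightarrow> ('a \<times> real) set" where
  "eepigraph f = {(x, t). f x \<le> ereal t}"

definition closed_fun :: "('a::topological_space \<Rightarrow> ereal) \<Rightarrow> bool" where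
  "closed_fun f \<longleftrightarrow> closed (eepigraph f)"

definition convex_fun :: "('a::real_vector \<Rightarrow> ereal) \<Rightarrow> bool" where
  "convex_fun f \<longleftrightarrow> convex (eepigraph f)"

definition delta :: "'a set \<Rightarrow> 'a \<Rightarrow> ereal" where
  "delta C x = (if x \<in> C then 0 else \<infinity>)"

definition Argmin :: "('a \<Rightarrow> ereal) \<Rightarrow> 'a set" where
  "Argmin f = {x. \<forall>y. f x \<le> f y}"

text \<open>
  Unlike \<^const>\<open>infdist\<close>, which is 0 for the empty set, this distance is \<open>\<infinity>\<close> there.
\<close>

definition edist_set :: "'a::real_normed_vector \<Rightarrow> 'a set \<Rightarrow> ereal" where
  "edist_set x C = (INF y\<in>C. ereal (norm (x - y)))"

text \<open>
  For proper \<open>f\<close> the subdifferential is empty outside \<open>edom f\<close>, since \<open>\<infinity> + ereal c = \<infinity>\<close>.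
\<close>

definition subdifferential :: "('a::real_inner \<Rightarrow> ereal) \<Rightarrow> 'a \<Rightarrow> 'a set" where
  "subdifferential f x = {v. \<forall>y. f x + ereal (v \<bullet> (y - x)) \<le> f y}"

definition dom_subdifferential :: "('a::real_inner \<Rightarrow> ereal) \<Rightarrow> 'a set" where
  "dom_subdifferential f = {x. subdifferential f x \<noteq> {}}"

text \<open>
  The difference \<open>f x - f xbar\<close> below is finite and positive, so \<^const>\<open>real_of_ereal\<close>
  is faithful and the derivative is taken in the open interval from 0 to \<open>r\<close>,
  where \<open>\<lambda>s. \<rho> * s powr (1 - \<alpha>)\<close> is smooth.
\<close>

definition KL_property_at :: "('a::real_inner \<Rightarrow> ereal) \<Rightarrow> real \<Rightarrow> 'a \<Rightarrow> bool" where
  "KL_property_at f \<alpha> xbar \<longleftrightarrow>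
     (\<exists>(r::ereal) (\<rho>::real) (U::'a set).
        0 < r \<and> 0 < \<rho> \<and> xbar \<in> interior U \<and>
        (\<forall>x\<in>U. f xbar < f x \<and> f x < f xbar + r \<longrightarrow>
           ereal (deriv (\<lambda>s. \<rho> * s powr (1 - \<alpha>)) (real_of_ereal (f x - f xbar)))
             * edist_set 0 (subdifferential f x) \<ge> 1))"

definition KL_function :: "('a::real_inner \<Rightarrow> ereal) \<Rightarrow> real \<Rightarrow> bool" where
  "KL_function f \<alpha> \<longleftrightarrow> (\<forall>xbar \<in> dom_subdifferential f. KL_property_at f \<alpha> xbar)"

text \<open>
  Real powers on the extended nonnegative half-line, with \<open>\<infinity>\<close> to a positive power being \<open>\<infinity>\<close>;
  only used with positive exponents, for which also \<open>0 powr p = 0\<close> is the usual value.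
\<close>

definition epowr :: "ereal \<Rightarrow> real \<Rightarrow> ereal" where
  "epowr t p = (if t = \<infinity> then \<infinity> else ereal (real_of_ereal t powr p))"

end

theory Submission
  imports Defs
begin

text \<open>
  Write \<open>C = {x \<in> \<Theta>. G x = b}\<close>, so that \<open>H\<close> is \<open>h0\<close> restricted to \<open>C\<close>, and \<open>m = min H\<close>. The KL inequality
  gives an error bound on \<open>C\<close>: for \<open>x \<in> C\<close> minimise \<open>z \<mapsto> (h0 z - m) powr (1 - \<alpha>) + l * norm (z - x)\<close> over the
  compact set \<open>C\<close> (a compact form of Ekeland's principle). A minimiser outside \<open>Argmin H\<close> would carry
  a subgradient of \<open>H\<close> too short for the KL inequality, so it lies in \<open>Argmin H\<close>.
  A point \<open>x \<in> \<Theta>\<close> outside \<open>C\<close> is moved into \<open>C\<close> along a segment of \<open>\<Theta>\<close> of relative length \<open>O(norm (G x - b))\<close>,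
  which is possible because \<open>b \<in> G ` ri \<Theta>\<close>; by convexity \<open>h0\<close> increases at most by a multiple of
  \<open>norm (G x - b)\<close>, and this is absorbed by the penalty.
\<close>

section \<open>Convex analysis: a lower bound of slope \<open>L\<close> yields a subgradient of norm
  at most \<open>L\<close>\<close>

text \<open>
  Separating the epigraph of \<open>f\<close> from the open cone below \<open>(y, f y)\<close> of slope \<open>L\<close> produces the subgradient.
\<close>

lemma subgradient_of_slope_bound:
  fixes f :: "'a::euclidean_space \<Rightarrow> real"
  assumes "convex_on C f" "y \<in> C" "0 \<le> L"
    and slope: "\<And>z. z \<in> C \<Longrightarrow> f y - L * norm (z - y) \<le> f z"
  obtains v where "norm v \<le> L" "\<And>z. z \<in> C \<Longrightarrow> f y + v \<bullet> (z - y) \<le> f z"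
proof -
  define A where "A = epigraph C f"
  \<comment> \<open>Strictness keeps \<open>B\<close> disjoint from the epigraph even above the
    apex, where \<open>slope\<close> is an equality.\<close>
  define B where "B = {zt. snd zt < f y - L * norm (fst zt - y)}"
  have "convex A"
    unfolding A_def using assms(1) by (rule convex_epigraphI)
  moreover have "convex B"
  proof (rule convexI)
    fix p q :: "'a \<times> real" and u v :: real
    assume pq: "p \<in> B" "q \<in> B" and uv: "0 \<le> u" "0 \<le> v" "u + v = 1"
    have "norm (u *\<^sub>R fst p + v *\<^sub>R fst q - y) = norm (u *\<^sub>R (fst p - y) + v *\<^sub>R (fst q - y))"
      using uv(3) by (simp add: algebra_simps flip: scaleR_add_left)
    also have "\<dots> \<le> u * norm (fst p - y) + v * norm (fst q - y)"
      using norm_triangle_ineq[of "u *\<^sub>R (fst p - y)" "v *\<^sub>R (fst q - y)"] uv by simp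
    finally have "L * norm (u *\<^sub>R fst p + v *\<^sub>R fst q - y)
        \<le> L * (u * norm (fst p - y) + v * norm (fst q - y))"
      using \<open>0 \<le> L\<close> by (rule mult_left_mono)
    moreover have "u * snd p + v * snd q
        < u * (f y - L * norm (fst p - y)) + v * (f y - L * norm (fst q - y))"
    \<comment> \<open>Strictness must come from a positive weight: from \<open>v\<close> when
      \<open>u = 0\<close>, and from \<open>u\<close> otherwise.\<close>
    proof (cases "u = 0")
      case True
      then show ?thesis using uv pq by (simp add: B_def)
    next
      case False
      then show ?thesis using uv pq unfolding B_def
        by (intro add_less_le_mono mult_strict_left_mono mult_left_mono) auto
    qed
    moreover have "u * (f y - L * norm (fst p - y)) + v * (f y - L * norm (fst q - y))
        = f y - L * (u * norm (fst p - y) + v * norm (fst q - y))"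
    proof -
      have "u * f y + v * f y = f y"
        using uv(3) by (metis distrib_right mult_1)
      then show ?thesis by (simp add: algebra_simps)
    qed
    ultimately show "u *\<^sub>R p + v *\<^sub>R q \<in> B"
      by (simp add: B_def)
  qed
  moreover have "(y, f y) \<in> A" "(y, f y - 1) \<in> B"
    using assms(2) by (auto simp: A_def B_def mem_epigraph)
  moreover have "A \<inter> B = {}"
    using slope by (force simp: A_def B_def epigraph_def)
  ultimately obtain n c where n: "n \<noteq> 0" and nA: "\<forall>p\<in>A. n \<bullet> p \<ge> c" and nB: "\<forall>p\<in>B. n \<bullet> p \<le> c"
    using separating_hyperplane_sets[of B A] by blast
  obtain a \<beta> where ab: "n = (a, \<beta>)" by (cases n)
  have B_le: "a \<bullet> z + \<beta> * t \<le> c" if "t < f y - L * norm (z - y)" for z t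
    using nB[rule_format, of "(z, t)"] that by (simp add: B_def ab)
  have A_ge: "a \<bullet> z + \<beta> * f z \<ge> c" if "z \<in> C" for z
    using nA[rule_format, of "(z, f z)"] that by (simp add: A_def ab mem_epigraph)
  have "\<beta> * (f y - 1) \<le> \<beta> * f y"
    using B_le[of "f y - 1" y] A_ge[OF assms(2)] by simp
  then have "0 \<le> \<beta>" by (simp add: algebra_simps)
  \<comment> \<open>A vertical hyperplane is impossible: \<open>B\<close> has points above all of
    the space, in particular above \<open>y + a\<close>, which lies on the wrong side.\<close>
  moreover have "\<beta> \<noteq> 0"
  proof
    assume "\<beta> = 0"
    then have "a \<noteq> 0" using n ab by (simp add: zero_prod_def)
    have "a \<bullet> (y + a) \<le> c"
      using B_le[of "f y - L * norm (y + a - y) - 1" "y + a"] \<open>\<beta> = 0\<close> by simp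
    moreover have "a \<bullet> y \<ge> c"
      using A_ge[OF assms(2)] \<open>\<beta> = 0\<close> by simp
    ultimately have "a \<bullet> a \<le> 0" by (simp add: inner_add_right)
    then show False using \<open>a \<noteq> 0\<close> by (simp add: inner_gt_zero_iff flip: not_less)
  qed
  ultimately have "0 < \<beta>" by simp
  \<comment> \<open>Letting \<open>e\<close> tend to 0 extends the inequality to the closure of
    \<open>B\<close>, which contains the apex \<open>(y, f y)\<close>.\<close>
  have B_cl: "a \<bullet> z + \<beta> * (f y - L * norm (z - y)) \<le> c" for z
  proof (rule field_le_epsilon)
    fix e :: real assume "0 < e"
    then show "a \<bullet> z + \<beta> * (f y - L * norm (z - y)) \<le> c + e"
      using B_le[of "f y - L * norm (z - y) - e / \<beta>" z] \<open>0 < \<beta>\<close>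
      by (simp add: algebra_simps)
  qed
  define v where "v = - (a /\<^sub>R \<beta>)"
  have v: "\<beta> * (v \<bullet> w) = - (a \<bullet> w)" for w
    using \<open>0 < \<beta>\<close> by (simp add: v_def)
  show thesis
  proof (rule that)
    \<comment> \<open>Since \<open>a\<close> is \<open>- \<beta>\<close> times \<open>v\<close>,
      moving from \<open>y\<close> by \<open>- v\<close> is the direction in which the cone bounds
      \<open>norm v\<close> most sharply.\<close>
    have "a \<bullet> (y - v) + \<beta> * (f y - L * norm v) \<le> a \<bullet> y + \<beta> * f y"
      using B_cl[of "y - v"] A_ge[OF assms(2)] by simp
    then have "\<beta> * (v \<bullet> v) \<le> \<beta> * (L * norm v)"
      unfolding v by (simp add: algebra_simps)
    then have "norm v * norm v \<le> L * norm v"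
      using \<open>0 < \<beta>\<close> by (simp add: dot_square_norm power2_eq_square)
    then show "norm v \<le> L"
      using \<open>0 \<le> L\<close> by (cases "v = 0") auto
  next
    fix z assume "z \<in> C"
    \<comment> \<open>At the apex, \<open>B_cl\<close> shows that the hyperplane supports the
      epigraph at \<open>(y, f y)\<close>.\<close>
    have "a \<bullet> y + \<beta> * f y \<le> a \<bullet> z + \<beta> * f z"
      using B_cl[of y] A_ge[OF \<open>z \<in> C\<close>] by simp
    then have "\<beta> * (f y + v \<bullet> (z - y)) \<le> \<beta> * f z"
      unfolding distrib_left v by (simp add: inner_diff_right)
    then show "f y + v \<bullet> (z - y) \<le> f z"
      using \<open>0 < \<beta>\<close> by simp
  qed
qed

section \<open>Moving points of a convex set into the slice \<open>G x = b\<close>\<close>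

text \<open>A relative interior point \<open>p\<close> of the slice leaves room of radius
  \<open>e\<close> inside the affine hull. The defect \<open>b - G x\<close> is lifted by a bounded
  right inverse of \<open>G\<close> to a direction \<open>d\<close>; pushing \<open>p\<close> by
  length at most \<open>e\<close> along \<open>d\<close> gives a \<open>w\<close> that overcorrects
  the defect, so a convex combination of \<open>x\<close> and \<open>w\<close> hits \<open>b\<close>
  exactly.\<close>

lemma retract_to_affine_slice:
  fixes G :: "'a::euclidean_space \<Rightarrow> 'b::euclidean_space"
  assumes "linear G" and "b \<in> G ` rel_interior S"
  obtains K where "0 < K"
    "\<And>x. x \<in> S \<Longrightarrow> \<exists>w\<in>S. \<exists>s. 0 \<le> s \<and> s \<le> 1 \<and> s \<le> K * norm (G x - b) \<and> G ((1 - s) *\<^sub>R x + s *\<^sub>R w) = b"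
proof -
  interpret G: linear G by fact
  obtain p where p: "p \<in> rel_interior S" "G p = b"
    using assms(2) by auto
  then obtain e where "p \<in> S" "0 < e" and e: "cball p e \<inter> affine hull S \<subseteq> S"
    by (auto simp: mem_rel_interior_cball)
  define V where "V = span ((\<lambda>x. x - p) ` S)"
  have V: "V = (\<lambda>x. x - p) ` (affine hull S)"
    unfolding V_def using diffs_affine_hull_span[OF \<open>p \<in> S\<close>] by simp
  \<comment> \<open>The range of \<open>g\<close> has to lie in \<open>V\<close>, so that moving
    \<open>p\<close> along \<open>d\<close> does not leave the affine hull of
    \<open>S\<close>.\<close>
  obtain g where g: "range g \<subseteq> V" "linear g" "\<And>v. v \<in> G ` V \<Longrightarrow> G (g v) = v"
    using linear_exists_right_inverse_on[OF assms(1), of V] by (auto simp: V_def)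
  obtain K where "0 < K" and K: "\<And>z. norm (g z) \<le> K * norm z"
    using linear_bounded_pos[OF g(2)] by blast
  show thesis
  proof (rule that)
    show "0 < K / e" using \<open>0 < K\<close> \<open>0 < e\<close> by simp
  next
    fix x assume "x \<in> S"
    define t where "t = K * norm (G x - b)"
    show "\<exists>w\<in>S. \<exists>s. 0 \<le> s \<and> s \<le> 1 \<and> s \<le> K / e * norm (G x - b) \<and> G ((1 - s) *\<^sub>R x + s *\<^sub>R w) = b"
    proof (cases "G x = b")
      case True
      then show ?thesis
        using \<open>x \<in> S\<close> by (intro bexI[of _ x] exI[of _ 0]) auto
    next
      case False
      then have "0 < t" using \<open>0 < K\<close> by (simp add: t_def)
      define d where "d = g (b - G x)"
      have "x - p \<in> V" unfolding V_def by (rule span_base) (use \<open>x \<in> S\<close> in auto)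
      then have "p - x \<in> V" unfolding V_def by (metis minus_diff_eq span_neg)
      then have "b - G x \<in> G ` V"
        by (auto simp: image_iff G.diff p(2) intro!: bexI[of _ "p - x"])
      then have Gd: "G d = b - G x" unfolding d_def by (rule g(3))
      have nd: "norm d \<le> t"
        using K[of "b - G x"] by (simp add: d_def t_def norm_minus_commute)
      have "(e / t) *\<^sub>R d \<in> V"
        using g(1) unfolding V_def d_def by (intro span_scale) auto
      then have "p + (e / t) *\<^sub>R d \<in> affine hull S"
        unfolding V by (auto simp: algebra_simps)
      moreover have "norm ((e / t) *\<^sub>R d) \<le> e"
        using nd \<open>0 < e\<close> \<open>0 < t\<close> by (simp add: field_simps)
      ultimately have wS: "p + (e / t) *\<^sub>R d \<in> S"
        using e by (auto simp: dist_norm)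
      \<comment> \<open>This \<open>s\<close> solves \<open>s * (e / t) = 1 - s\<close>: the share
        of \<open>G d\<close> carried by \<open>w\<close> then cancels the defect left by
        \<open>x\<close>.\<close>
      define s where "s = t / (e + t)"
      have s: "0 \<le> s" "s \<le> 1" "s \<le> t / e"
        using \<open>0 < t\<close> \<open>0 < e\<close> by (auto simp: s_def field_simps)
      have s': "s * (e / t) = 1 - s"
        using \<open>0 < t\<close> \<open>0 < e\<close> by (simp add: s_def divide_simps)
      have "G ((1 - s) *\<^sub>R x + s *\<^sub>R (p + (e / t) *\<^sub>R d))
          = (1 - s) *\<^sub>R G x + s *\<^sub>R b + (s * (e / t)) *\<^sub>R G d"
        by (simp add: G.add G.scale p(2) scaleR_add_right)
      also have "\<dots> = b"
        unfolding s' Gd by (simp add: algebra_simps)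
      finally show ?thesis
        using wS s \<open>0 < e\<close> by (intro bexI[OF _ wS] exI[of _ s]) (auto simp: t_def)
    qed
  qed
qed

section \<open>From the KL inequality to an error bound on a compact convex set\<close>

text \<open>Concavity of the power, obtained from Young's inequality for positive \<open>b\<close>.
  It replaces a chain rule: a slope bound for a power of \<open>f\<close> becomes one for
  \<open>f\<close> itself.\<close>

lemma powr_le_tangent:
  fixes a b p :: real
  assumes "0 < a" "0 \<le> b" "0 < p" "p \<le> 1"
  shows "b powr p \<le> a powr p + p * a powr (p - 1) * (b - a)"
proof (cases "b = 0")
  case True
  have "p * a powr (p - 1) * (0 - a) = - (p * a powr p)"
    using assms(1) by (simp add: powr_diff)
  moreover have "p * a powr p \<le> 1 * a powr p"
    using assms by (intro mult_right_mono) auto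
  moreover have "(0::real) powr p = 0" by simp
  ultimately show ?thesis unfolding True by linarith
next
  case False
  then have "b powr p * a powr (1 - p) \<le> p * b + (1 - p) * a"
    using assms by (intro Youngs_inequality_0) auto
  then have "b powr p * a powr (1 - p) * a powr (p - 1) \<le> (p * b + (1 - p) * a) * a powr (p - 1)"
    by (intro mult_right_mono) auto
  also have "\<dots> = a * a powr (p - 1) + p * a powr (p - 1) * (b - a)"
    by (simp add: algebra_simps)
  also have "a * a powr (p - 1) = a powr p"
    using assms(1) by (simp add: powr_diff)
  finally have "b powr p * (a powr (1 - p) * a powr (p - 1)) \<le> a powr p + p * a powr (p - 1) * (b - a)"
    by (simp only: mult.assoc)
  moreover have "a powr (1 - p) * a powr (p - 1) = 1"
    using assms(1) by (simp flip: powr_add)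
  ultimately show ?thesis by simp
qed

text \<open>The distance from 0 to the subdifferential is at most the norm of any single
  subgradient, which frees the KL inequality from extended reals. The factor
  \<open>1 - \<alpha>\<close> of the derivative goes into the new \<open>\<rho>\<close>.\<close>

lemma KL_property_at_real:
  assumes "KL_property_at H \<alpha> xb" and "H xb = ereal m" and "\<alpha> < 1"
  obtains r \<rho> \<delta> :: real where "0 < r" "0 < \<rho>" "0 < \<delta>"
    "\<And>y s v. dist xb y < \<delta> \<Longrightarrow> H y = ereal s \<Longrightarrow> m < s \<Longrightarrow> s < m + r \<Longrightarrow> v \<in> subdifferential H y
       \<Longrightarrow> (s - m) powr \<alpha> \<le> \<rho> * norm v"
proof -
  obtain r' \<rho> U where "0 < r'" "0 < \<rho>" "xb \<in> interior U" and
    KL: "\<And>x. x \<in> U \<Longrightarrow> H xb < H x \<Longrightarrow> H x < H xb + r' \<Longrightarrow>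
      ereal (deriv (\<lambda>s. \<rho> * s powr (1 - \<alpha>)) (real_of_ereal (H x - H xb)))
             * edist_set 0 (subdifferential H x) \<ge> 1"
    using assms(1) unfolding KL_property_at_def by blast
  obtain \<delta> where "0 < \<delta>" and \<delta>: "ball xb \<delta> \<subseteq> U"
    using \<open>xb \<in> interior U\<close> mem_interior by blast
  \<comment> \<open>The radius \<open>r'\<close> may be infinite; any positive real below it
    serves.\<close>
  obtain r where "0 < r" "ereal r < r'"
    using ereal_dense2[OF \<open>0 < r'\<close>] by auto
  show thesis
  proof (rule that[OF \<open>0 < r\<close> _ \<open>0 < \<delta>\<close>])
    show "0 < \<rho> * (1 - \<alpha>)" using \<open>0 < \<rho>\<close> assms(3) by simp
  next
    fix y s v
    assume *: "dist xb y < \<delta>" "H y = ereal s" "m < s" "s < m + r" "v \<in> subdifferential H y"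
    define D where "D = deriv (\<lambda>s. \<rho> * s powr (1 - \<alpha>)) (s - m)"
    have "((\<lambda>s. \<rho> * s powr (1 - \<alpha>)) has_real_derivative \<rho> * ((1 - \<alpha>) * (s - m) powr (1 - \<alpha> - 1))) (at (s - m))"
      using *(3) by (auto intro!: derivative_eq_intros)
    then have D: "D = \<rho> * (1 - \<alpha>) * (s - m) powr (- \<alpha>)"
      unfolding D_def by (simp add: DERIV_imp_deriv)
    then have "0 \<le> D" using \<open>0 < \<rho>\<close> assms(3) by simp
    have "H y < H xb + r'"
    proof -
      have "H y < ereal m + ereal r" using * by simp
      also have "\<dots> \<le> ereal m + r'" using \<open>ereal r < r'\<close> by (intro add_left_mono) simp
      finally show ?thesis using assms(2) by simp
    qed
    then have "1 \<le> ereal D * edist_set 0 (subdifferential H y)"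
      using KL[of y] * \<delta> assms(2) unfolding D_def by auto
    also have "\<dots> \<le> ereal D * ereal (norm v)"
      unfolding edist_set_def using \<open>0 \<le> D\<close> INF_lower[OF *(5), of "\<lambda>y. ereal (norm (0 - y))"]
      by (intro ereal_mult_left_mono) auto
    finally have "1 \<le> D * norm v" by (simp add: one_ereal_def)
    then have "(s - m) powr \<alpha> * 1 \<le> (s - m) powr \<alpha> * (D * norm v)"
      by (intro mult_left_mono) auto
    also have "\<dots> = ((s - m) powr \<alpha> * (s - m) powr (- \<alpha>)) * (\<rho> * (1 - \<alpha>) * norm v)"
      unfolding D by (simp add: mult_ac)
    also have "(s - m) powr \<alpha> * (s - m) powr (- \<alpha>) = 1"
      using *(3) by (simp flip: powr_add)
    finally show "(s - m) powr \<alpha> \<le> \<rho> * (1 - \<alpha>) * norm v" by simp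
  qed
qed

text \<open>The KL constants depend on the minimiser, and compactness makes them uniform. Otherwise
  the constants \<open>inverse (Suc n)\<close> and \<open>Suc n\<close> fail for every
  \<open>n\<close> at some point of \<open>C\<close>; these points accumulate at a minimiser, whose
  own KL constants they eventually contradict.\<close>

lemma KL_uniform_near_Argmin:
  fixes H :: "'a::euclidean_space \<Rightarrow> ereal"
  assumes "compact C" "continuous_on C f"
    and H: "\<And>x. x \<in> C \<Longrightarrow> H x = ereal (f x)"
    and m: "x0 \<in> C" "x0 \<in> Argmin H"
    and "\<alpha> < 1" "KL_function H \<alpha>"
  obtains r \<rho> :: real where "0 < r" "0 < \<rho>"
    "\<And>y v. y \<in> C \<Longrightarrow> f x0 < f y \<Longrightarrow> f y < f x0 + r \<Longrightarrow> v \<in> subdifferential H y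
       \<Longrightarrow> (f y - f x0) powr \<alpha> \<le> \<rho> * norm v"
proof (rule ccontr)
  assume "\<not> thesis"
  note no = this
  have "\<exists>y v. y \<in> C \<and> f x0 < f y \<and> f y < f x0 + inverse (Suc n) \<and> v \<in> subdifferential H y
      \<and> (f y - f x0) powr \<alpha> > Suc n * norm v" for n
  proof (rule ccontr)
    assume "\<not> ?thesis"
    then show False
      using no that[of "inverse (Suc n)" "Suc n"] by (force simp: not_less)
  qed
  then obtain Y v where Y: "\<And>n. Y n \<in> C" "\<And>n. f x0 < f (Y n)" "\<And>n. f (Y n) < f x0 + inverse (Suc n)"
    and v: "\<And>n. v n \<in> subdifferential H (Y n)" "\<And>n. (f (Y n) - f x0) powr \<alpha> > Suc n * norm (v n)"
    by metis
  obtain l k where "l \<in> C" "strict_mono k" and lim: "(Y \<circ> k) \<longlonglongrightarrow> l"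
    using \<open>compact C\<close> Y(1) unfolding compact_def by blast
  have "(\<lambda>n. f ((Y \<circ> k) n)) \<longlonglongrightarrow> f l"
    using continuous_on_tendsto_compose[OF assms(2) lim \<open>l \<in> C\<close>] Y(1) by simp
  moreover have "(\<lambda>n. f x0 + inverse (Suc (k n))) \<longlonglongrightarrow> f x0 + 0"
    using LIMSEQ_subseq_LIMSEQ[OF LIMSEQ_inverse_real_of_nat \<open>strict_mono k\<close>]
    by (intro tendsto_add tendsto_const) (simp add: o_def)
  ultimately have "f l \<le> f x0 + 0"
    using Y(3) by (intro LIMSEQ_le) (auto intro!: exI[of _ 0] less_imp_le)
  moreover have "f x0 \<le> f l"
    using m H \<open>l \<in> C\<close> unfolding Argmin_def by (metis ereal_less_eq(3) mem_Collect_eq)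
  ultimately have fl: "f l = f x0" by simp
  then have "l \<in> Argmin H"
    using m H \<open>l \<in> C\<close> unfolding Argmin_def by simp
  then have "0 \<in> subdifferential H l"
    by (simp add: Argmin_def subdifferential_def)
  then have "KL_property_at H \<alpha> l"
    using assms(7) unfolding KL_function_def dom_subdifferential_def by blast
  then obtain r \<rho> \<delta> where pos: "0 < r" "0 < \<rho>" "0 < \<delta>" and
    KL: "\<And>y s v. dist l y < \<delta> \<Longrightarrow> H y = ereal s \<Longrightarrow> f x0 < s \<Longrightarrow> s < f x0 + r \<Longrightarrow> v \<in> subdifferential H y
       \<Longrightarrow> (s - f x0) powr \<alpha> \<le> \<rho> * norm v"
    using KL_property_at_real[of H \<alpha> l "f x0"] H[OF \<open>l \<in> C\<close>] fl assms(6) by metis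
  have "eventually (\<lambda>n. dist l (Y (k n)) < \<delta>) sequentially"
    using tendstoD[OF lim \<open>0 < \<delta>\<close>] by (simp add: dist_commute)
  moreover have "eventually (\<lambda>n. inverse (real (Suc (k n))) < r) sequentially"
    using LIMSEQ_subseq_LIMSEQ[OF LIMSEQ_inverse_real_of_nat \<open>strict_mono k\<close>] \<open>0 < r\<close>
    by (auto simp: o_def dest: order_tendstoD(2))
  \<comment> \<open>Together with \<open>n \<le> k n\<close> this puts the local
    \<open>\<rho>\<close> below the factor \<open>Suc (k n)\<close> that failed.\<close>
  moreover have "eventually (\<lambda>n. \<rho> \<le> real n) sequentially"
    using filterlim_real_sequentially by (simp add: filterlim_at_top)
  ultimately have "eventually (\<lambda>n. False) sequentially"
  proof eventually_elim
    case (elim n)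
    have "(f (Y (k n)) - f x0) powr \<alpha> \<le> \<rho> * norm (v (k n))"
      using KL[OF elim(1) H[OF Y(1)] Y(2) _ v(1)] Y(3)[of "k n"] elim(2) by simp
    also have "\<dots> \<le> Suc (k n) * norm (v (k n))"
      using elim(3) seq_suble[OF \<open>strict_mono k\<close>, of n] by (intro mult_right_mono) auto
    finally show ?case using v(2)[of "k n"] by simp
  qed
  then show False by simp
qed

text \<open>The variational argument settles values below \<open>f x0 + r\<close>. Above that level
  the power is bounded away from 0 while \<open>C\<close> is bounded, so a large constant
  suffices.\<close>

lemma KL_error_bound:
  fixes H :: "'a::euclidean_space \<Rightarrow> ereal"
  assumes "compact C" "convex_on C f" "continuous_on C f"
    and H: "\<And>x. H x = (if x \<in> C then ereal (f x) else \<infinity>)"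
    and m: "x0 \<in> C" "x0 \<in> Argmin H"
    and \<alpha>: "0 \<le> \<alpha>" "\<alpha> < 1" "KL_function H \<alpha>"
  obtains c where "0 < c" "\<And>x. x \<in> C \<Longrightarrow> \<exists>y\<in>Argmin H. norm (x - y) \<le> c * (f x - f x0) powr (1 - \<alpha>)"
proof -
  have min: "f x0 \<le> f x" if "x \<in> C" for x
    using m(2) m(1) that unfolding Argmin_def H by (force dest: spec[of _ x])
  have Argmin: "y \<in> Argmin H" if "y \<in> C" "f y = f x0" for y
    using that m unfolding Argmin_def H by simp
  obtain r \<rho> where "0 < r" "0 < \<rho>" and KL:
    "\<And>y v. y \<in> C \<Longrightarrow> f x0 < f y \<Longrightarrow> f y < f x0 + r \<Longrightarrow> v \<in> subdifferential H y
       \<Longrightarrow> (f y - f x0) powr \<alpha> \<le> \<rho> * norm v"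
    using KL_uniform_near_Argmin[of C f H x0 \<alpha>] assms by auto
  define \<psi> where "\<psi> = (\<lambda>x. (f x - f x0) powr (1 - \<alpha>))"
  \<comment> \<open>The 2 makes the subgradient found below too short by a factor of two:
    \<open>\<rho> * L = a powr \<alpha> / 2\<close>.\<close>
  define l where "l = (1 - \<alpha>) / (2 * \<rho>)"
  have "0 < l" using \<alpha> \<open>0 < \<rho>\<close> by (simp add: l_def)
  have near: "\<exists>y\<in>Argmin H. norm (x - y) \<le> 1 / l * \<psi> x" if x: "x \<in> C" "f x < f x0 + r" for x
  proof -
    have "continuous_on C (\<lambda>z. \<psi> z + l * norm (z - x))"
      unfolding \<psi>_def using assms(3) \<alpha> min by (intro continuous_intros continuous_on_powr') auto
    then obtain y where "y \<in> C" and y: "\<And>z. z \<in> C \<Longrightarrow> \<psi> y + l * norm (y - x) \<le> \<psi> z + l * norm (z - x)"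
      using continuous_attains_inf[of C "\<lambda>z. \<psi> z + l * norm (z - x)"] \<open>compact C\<close> x(1) by blast
    have yx: "\<psi> y + l * norm (x - y) \<le> \<psi> x"
      using y[OF x(1)] by (simp add: norm_minus_commute)
    have y0: "0 \<le> \<psi> y" by (simp add: \<psi>_def)
    have "f y = f x0"
    proof (rule ccontr)
      assume "f y \<noteq> f x0"
      then have "0 < f y - f x0" using min[OF \<open>y \<in> C\<close>] by simp
      define a where "a = f y - f x0"
      have "0 < a" unfolding a_def by fact
      \<comment> \<open>The value at \<open>y\<close> stays below \<open>f x0 + r\<close>, so the KL
        inequality is available at \<open>y\<close>.\<close>
      have "\<psi> y \<le> \<psi> x" using yx \<open>0 < l\<close> by (smt (verit) mult_nonneg_nonneg norm_ge_zero)
      then have "f y \<le> f x"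
        using \<alpha> min[OF \<open>y \<in> C\<close>] min[OF x(1)] unfolding \<psi>_def
        by (smt (verit) powr_less_mono2)
      \<comment> \<open>\<open>L\<close> is \<open>l\<close> divided by the derivative of
        \<open>s powr (1 - \<alpha>)\<close> at \<open>a\<close>.\<close>
      define L where "L = l / (1 - \<alpha>) * a powr \<alpha>"
      have "0 \<le> L" using \<open>0 < l\<close> \<alpha> by (simp add: L_def)
      have slope: "f y - L * norm (z - y) \<le> f z" if "z \<in> C" for z
      proof -
        have "\<psi> y - l * norm (z - y) \<le> \<psi> z"
        proof -
          have "l * norm (z - x) \<le> l * norm (z - y) + l * norm (y - x)"
            using \<open>0 < l\<close> norm_triangle_ineq[of "z - y" "y - x"] by (simp flip: distrib_left)
          then show ?thesis using y[OF that] by simp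
        qed
        also have "\<psi> z \<le> a powr (1 - \<alpha>) + (1 - \<alpha>) * a powr (- \<alpha>) * (f z - f y)"
          using powr_le_tangent[of a "f z - f x0" "1 - \<alpha>"] \<open>0 < a\<close> min[OF that] \<alpha>
          unfolding \<psi>_def by (simp add: a_def)
        also have "a powr (1 - \<alpha>) = \<psi> y" by (simp add: a_def \<psi>_def)
        finally have "(1 - \<alpha>) * a powr (- \<alpha>) * (f y - f z) \<le> l * norm (z - y)"
          by (simp add: algebra_simps)
        then have "a powr \<alpha> / (1 - \<alpha>) * ((1 - \<alpha>) * a powr (- \<alpha>) * (f y - f z))
            \<le> a powr \<alpha> / (1 - \<alpha>) * (l * norm (z - y))"
          using \<alpha> by (intro mult_left_mono) auto
        moreover have "a powr \<alpha> / (1 - \<alpha>) * ((1 - \<alpha>) * a powr (- \<alpha>) * (f y - f z)) = f y - f z"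
          using \<open>0 < a\<close> \<alpha> by (simp add: powr_minus field_simps)
        ultimately show ?thesis by (simp add: L_def mult_ac)
      qed
      obtain v where "norm v \<le> L" and v: "\<And>z. z \<in> C \<Longrightarrow> f y + v \<bullet> (z - y) \<le> f z"
        using subgradient_of_slope_bound[OF assms(2) \<open>y \<in> C\<close> \<open>0 \<le> L\<close> slope] by blast
      have "v \<in> subdifferential H y"
        using v \<open>y \<in> C\<close> by (simp add: subdifferential_def H)
      then have "a powr \<alpha> \<le> \<rho> * norm v"
        using KL[OF \<open>y \<in> C\<close>] \<open>0 < f y - f x0\<close> \<open>f y \<le> f x\<close> x(2) by (simp add: a_def)
      also have "\<dots> \<le> \<rho> * L" using \<open>norm v \<le> L\<close> \<open>0 < \<rho>\<close> by simp
      also have "\<dots> = a powr \<alpha> / 2"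
        using \<open>0 < \<rho>\<close> \<alpha> by (simp add: L_def l_def)
      finally show False using \<open>0 < a\<close> by simp
    qed
    moreover have "norm (x - y) \<le> 1 / l * \<psi> x"
      using yx y0 \<open>0 < l\<close> by (simp add: field_simps)
    ultimately show ?thesis using Argmin \<open>y \<in> C\<close> by blast
  qed
  obtain D where D: "0 < D" "\<And>x. x \<in> C \<Longrightarrow> norm (x - x0) \<le> D"
  proof -
    have "bounded ((\<lambda>x. x - x0) ` C)"
      using \<open>compact C\<close> by (simp add: compact_imp_bounded bounded_translation_minus)
    then show thesis using that unfolding bounded_pos by auto
  qed
  define c where "c = 1 / l + D / r powr (1 - \<alpha>)"
  show thesis
  proof (rule that)
    show "0 < c" using \<open>0 < l\<close> D(1) \<open>0 < r\<close> by (simp add: c_def add_pos_pos)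
  next
    fix x assume "x \<in> C"
    have 1: "1 / l * \<psi> x \<le> c * \<psi> x"
      using D(1) by (intro mult_right_mono) (auto simp: c_def \<psi>_def)
    show "\<exists>y\<in>Argmin H. norm (x - y) \<le> c * (f x - f x0) powr (1 - \<alpha>)"
    proof (cases "f x < f x0 + r")
      case True
      then show ?thesis using near[OF \<open>x \<in> C\<close> True] 1 unfolding \<psi>_def by (meson order_trans)
    next
      case False
      \<comment> \<open>The fixed minimiser \<open>x0\<close> is near enough here.\<close>
      have "norm (x - x0) \<le> D / r powr (1 - \<alpha>) * r powr (1 - \<alpha>)"
        using D(2)[OF \<open>x \<in> C\<close>] \<open>0 < r\<close> by simp
      also have "\<dots> \<le> D / r powr (1 - \<alpha>) * \<psi> x"
        unfolding \<psi>_def using False \<open>0 < r\<close> \<alpha> D(1) by (intro mult_left_mono powr_mono2) auto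
      also have "\<dots> \<le> c * \<psi> x"
        using \<open>0 < l\<close> by (intro mult_right_mono) (auto simp: c_def \<psi>_def)
      finally show ?thesis using m(2) unfolding \<psi>_def by blast
    qed
  qed
qed

section \<open>The penalised error bound\<close>

theorem theorem4p4:
  fixes h H :: "'a::euclidean_space \<Rightarrow> ereal"
    and h0 :: "'a \<Rightarrow> real"
    and \<Theta> :: "'a set"
    and G :: "'a \<Rightarrow> 'b::euclidean_space"
    and b :: 'b
    and \<alpha> :: real
  assumes "proper_fun h" and "closed_fun h" and "convex_fun h"
    and "linear G"
    and "b \<in> G ` rel_interior (edom h)"
    and "compact \<Theta>" and "convex \<Theta>"
    and "convex_on UNIV h0"
    and "\<And>x. h x = ereal (h0 x) + delta \<Theta> x"
    and "\<And>x. H x = h x + delta {b} (G x)"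
    and "0 \<le> \<alpha>" and "\<alpha> < 1"
    and "KL_function H \<alpha>"
  shows "\<exists>(\<epsilon>::real) (c\<^sub>0::real) (\<eta>::real). \<epsilon> > 0 \<and> c\<^sub>0 > 0 \<and> \<eta> > 0 \<and>
           (\<forall>x. edist_set x (Argmin H) \<le> ereal \<epsilon> \<longrightarrow>
              edist_set x (Argmin H)
                \<le> ereal c\<^sub>0 * epowr \<bar>h x + ereal (\<eta> * norm (G x - b)) - (INF y. H y)\<bar> (1 - \<alpha>))"
proof -
  interpret G: linear G by fact
  define C where "C = {x \<in> \<Theta>. G x = b}"
  have hf: "h x = (if x \<in> \<Theta> then ereal (h0 x) else \<infinity>)" for x
    using assms(9)[of x] by (simp add: delta_def)
  have Hf: "H x = (if x \<in> C then ereal (h0 x) else \<infinity>)" for x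
    using assms(10)[of x] by (simp add: delta_def hf C_def)
  have dom: "edom h = \<Theta>" by (auto simp: edom_def hf)
  have cont: "continuous_on UNIV h0"
    using assms(8) by (rule convex_on_continuous[OF open_UNIV])
  have contS: "continuous_on S h0" for S
    using cont by (rule continuous_on_subset) simp
  have contG: "continuous_on S G" for S
    using assms(4) linear_continuous_on linear_linear by blast
  have "C = \<Theta> \<inter> G -` {b}" by (auto simp: C_def)
  then have "compact C" "convex C"
    using assms(4,6,7) contG[of UNIV]
    by (auto intro!: compact_Int_closed convex_Int convex_linear_vimage continuous_closed_vimage
        simp: continuous_on_eq_continuous_at)
  have "C \<noteq> {}"
    using assms(5) rel_interior_subset unfolding dom C_def by fastforce
  then obtain x0 where x0: "x0 \<in> C" "\<And>y. y \<in> C \<Longrightarrow> h0 x0 \<le> h0 y"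
    using continuous_attains_inf[OF \<open>compact C\<close> _ contS[of C]] by blast
  then have "x0 \<in> Argmin H" by (simp add: Argmin_def Hf)
  define m where "m = h0 x0"
  have inf: "(INF y. H y) = ereal m"
  proof (rule antisym)
    show "(INF y. H y) \<le> ereal m"
      using INF_lower[of x0 UNIV H] x0(1) by (simp add: Hf m_def)
    show "ereal m \<le> (INF y. H y)"
      using x0(2) by (intro INF_greatest) (simp add: Hf m_def)
  qed
  obtain c where "0 < c" and
    c: "\<And>x. x \<in> C \<Longrightarrow> \<exists>y\<in>Argmin H. norm (x - y) \<le> c * (h0 x - m) powr (1 - \<alpha>)"
    unfolding m_def
  proof (rule KL_error_bound[OF \<open>compact C\<close> _ contS Hf x0(1) \<open>x0 \<in> Argmin H\<close> assms(11-13)])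
    show "convex_on C h0"
      using assms(8) \<open>convex C\<close> by (rule convex_on_subset[OF _ subset_UNIV])
  qed blast
  obtain K where "0 < K" and
    K: "\<And>x. x \<in> \<Theta> \<Longrightarrow> \<exists>w\<in>\<Theta>. \<exists>s. 0 \<le> s \<and> s \<le> 1 \<and> s \<le> K * norm (G x - b) \<and> G ((1 - s) *\<^sub>R x + s *\<^sub>R w) = b"
    using retract_to_affine_slice[OF assms(4,5)] unfolding dom by blast
  obtain M where "0 < M" and M: "\<And>x. x \<in> \<Theta> \<Longrightarrow> \<bar>h0 x\<bar> \<le> M"
  proof -
    have "bounded (h0 ` \<Theta>)"
      using assms(6) contS by (intro compact_imp_bounded compact_continuous_image)
    then show thesis using that unfolding bounded_pos by auto
  qed
  obtain R where "0 < R" and R: "\<And>x. x \<in> \<Theta> \<Longrightarrow> norm x \<le> R"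
    using compact_imp_bounded[OF assms(6)] unfolding bounded_pos by auto
  obtain N where "0 < N" and N: "\<And>x. x \<in> \<Theta> \<Longrightarrow> norm (G x - b) \<le> N"
  proof -
    have "bounded ((\<lambda>x. G x - b) ` \<Theta>)"
      using assms(6) contG by (intro compact_imp_bounded compact_continuous_image continuous_on_diff continuous_on_const)
    then show thesis using that unfolding bounded_pos by auto
  qed
  \<comment> \<open>\<open>2 * M * K\<close> pays for the increase of \<open>h0\<close> on the way
    into \<open>C\<close>; the extra 1 makes the residual \<open>F\<close> dominate
    \<open>norm (G x - b)\<close>.\<close>
  define \<eta> where "\<eta> = 2 * M * K + 1"
  \<comment> \<open>An upper bound on \<open>\<Theta>\<close> for the residual
    \<open>F\<close>.\<close>
  define B where "B = 2 * M + \<eta> * N"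
  have "0 < \<eta>" "0 < B"
    using \<open>0 < M\<close> \<open>0 < K\<close> \<open>0 < N\<close> by (simp_all add: \<eta>_def B_def add_pos_pos)
  \<comment> \<open>One summand for each leg: from \<open>x\<close> to \<open>z\<close> in
    \<open>C\<close>, then from \<open>z\<close> to \<open>Argmin H\<close>.\<close>
  define c0 where "c0 = 2 * R * K * B powr \<alpha> + c"
  have "0 < c0" using \<open>0 < c\<close> \<open>0 < R\<close> \<open>0 < K\<close> \<open>0 < B\<close> by (simp add: c0_def add_pos_pos)
  have "edist_set x (Argmin H) \<le> ereal c0 * epowr \<bar>h x + ereal (\<eta> * norm (G x - b)) - (INF y. H y)\<bar> (1 - \<alpha>)" for x
  proof (cases "x \<in> \<Theta>")
    case False
    \<comment> \<open>Here \<open>h x\<close> is infinite, and so is the right-hand side.\<close>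
    then show ?thesis using \<open>0 < c0\<close> by (simp add: hf inf epowr_def)
  next
    case True
    define t where "t = norm (G x - b)"
    define F where "F = h0 x + \<eta> * t - m"
    obtain w s where "w \<in> \<Theta>" and s: "0 \<le> s" "s \<le> 1" "s \<le> K * t" and Gw: "G ((1 - s) *\<^sub>R x + s *\<^sub>R w) = b"
      using K[OF True] unfolding t_def by blast
    define z where "z = (1 - s) *\<^sub>R x + s *\<^sub>R w"
    have "z \<in> C"
      using Gw True \<open>w \<in> \<Theta>\<close> s(1,2) convexD_alt[OF assms(7)] by (simp add: C_def z_def)
    have xz: "norm (x - z) \<le> 2 * R * K * t"
    proof -
      have "x - z = s *\<^sub>R (x - w)" by (simp add: z_def algebra_simps)
      then have "norm (x - z) = s * norm (x - w)" using s(1) by simp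
      also have "\<dots> \<le> (K * t) * (2 * R)"
        using s R[OF True] R[OF \<open>w \<in> \<Theta>\<close>] norm_triangle_ineq4[of x w] by (intro mult_mono) auto
      finally show ?thesis by (simp add: mult_ac)
    qed
    have hz: "h0 z \<le> h0 x + 2 * M * K * t"
    proof -
      have "h0 z \<le> (1 - s) * h0 x + s * h0 w"
        unfolding z_def using convex_onD[OF assms(8)] s(1,2) by simp
      also have "\<dots> = h0 x + s * (h0 w - h0 x)" by (simp add: algebra_simps)
      also have "s * (h0 w - h0 x) \<le> s * (2 * M)"
        using s(1) M[OF True] M[OF \<open>w \<in> \<Theta>\<close>] by (intro mult_left_mono) auto
      also have "\<dots> \<le> (K * t) * (2 * M)"
        using s(3) \<open>0 < M\<close> by (intro mult_right_mono) auto
      finally show ?thesis by (simp add: mult_ac)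
    qed
    have "0 \<le> t" by (simp add: t_def)
    have "m \<le> h0 z" using x0(2)[OF \<open>z \<in> C\<close>] by (simp add: m_def)
    have F: "h0 z - m \<le> F" "t \<le> F" "0 \<le> F"
      using hz \<open>0 \<le> t\<close> \<open>m \<le> h0 z\<close> by (simp_all add: F_def \<eta>_def algebra_simps)
    have "F \<le> B"
    proof -
      have "\<eta> * t \<le> \<eta> * N" using N[OF True] \<open>0 < \<eta>\<close> by (simp add: t_def)
      moreover have "\<bar>m\<bar> \<le> M" using M x0(1) by (simp add: C_def m_def)
      ultimately show ?thesis using M[OF True] by (simp add: F_def B_def)
    qed
    \<comment> \<open>Boundedness of \<open>F\<close> trades the linear bound
      \<open>t \<le> F\<close> for one with exponent \<open>1 - \<alpha>\<close>. The splitting of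
      \<open>F\<close> also holds at \<open>F = 0\<close>, as \<open>0 powr 0 = 0\<close>.\<close>
    have "t \<le> B powr \<alpha> * F powr (1 - \<alpha>)"
    proof -
      have "F = F powr \<alpha> * F powr (1 - \<alpha>)"
        using F(3) by (simp flip: powr_add)
      also have "\<dots> \<le> B powr \<alpha> * F powr (1 - \<alpha>)"
        using F(3) \<open>F \<le> B\<close> assms(11) by (intro mult_right_mono powr_mono2) auto
      finally show ?thesis using F(2) by simp
    qed
    then have "2 * R * K * t \<le> 2 * R * K * (B powr \<alpha> * F powr (1 - \<alpha>))"
      using \<open>0 < R\<close> \<open>0 < K\<close> by simp
    then have xz': "norm (x - z) \<le> 2 * R * K * B powr \<alpha> * F powr (1 - \<alpha>)"
      using xz by (simp add: mult.assoc)
    obtain y where "y \<in> Argmin H" and y: "norm (z - y) \<le> c * (h0 z - m) powr (1 - \<alpha>)"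
      using c[OF \<open>z \<in> C\<close>] by blast
    have "c * (h0 z - m) powr (1 - \<alpha>) \<le> c * F powr (1 - \<alpha>)"
      using F(1) \<open>m \<le> h0 z\<close> \<open>0 < c\<close> assms(12) by (intro mult_left_mono powr_mono2) auto
    then have "norm (x - y) \<le> c0 * F powr (1 - \<alpha>)"
      using xz' y norm_triangle_ineq[of "x - z" "z - y"] by (simp add: c0_def algebra_simps)
    moreover have "edist_set x (Argmin H) \<le> ereal (norm (x - y))"
      unfolding edist_set_def using \<open>y \<in> Argmin H\<close> by (rule INF_lower)
    moreover have "\<bar>h x + ereal (\<eta> * norm (G x - b)) - (INF y. H y)\<bar> = ereal F"
      using True F(3) by (simp add: hf inf F_def t_def)
    ultimately show ?thesis by (simp add: epowr_def) (meson ereal_less_eq(3) order_trans)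
  qed
  then show ?thesis
    using \<open>0 < c0\<close> \<open>0 < \<eta>\<close> by (intro exI[of _ 1] exI[of _ c0] exI[of _ \<eta>]) simp
qed

end
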